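(* Let $P_0=\frac{\gamma P_{\rm atm}}{\rho gh_{\rm ch}}$, let $m_{\rm wc}$ be the dimensionless water column mass and let $m_{\rm add}$ be the dimensionless added mass, given by $$m_{\rm add}=\frac{L^2}{h_0^2}\Big(\alpha|\mathcal E_+|+\frac{|\mathcal E_+|^2}{3h_{\rm wc}}\Big)\quad\text{when }\widetilde\mu=0,$$ $$m_{\rm add}=\frac{L^2}{h_0^2}\Big(\alpha|\mathcal E_+|+\frac{|\mathcal E_+|^2}{3h_{\rm wc}}\Big)+\frac{L|\mathcal E_+|}{h_0\sqrt3\,h(-r)}+\frac1{3h_{\rm wc}}\quad\text{when }\widetilde\mu\ne0.$$ Let the hydrostatic buoyancy period be $2\pi T_{\rm buo}$ with $T_{\rm buo}^2=\frac{m_{\rm wc}h_0^2}{L^2}$, and the effective buoyancy period be $2\pi\mathfrak T_{\rm buo}$ with $$\mathfrak T_{\rm buo}^2=\frac{\mathcal T_{\rm buo}^2(h_{\rm wc})}{1+P_0}\ \text{ for }\widetilde\mu=0,\qquad\mathfrak T_{\rm buo}^2=\frac{\mathcal T^2_{\widetilde\mu,\rm buo}(h,h_{\rm wc})}{1+P_0}\ \text{ for }\widetilde\mu\ne0 .$$ Then: 1. if $P_0m_{\rm wc}<m_{\rm add}$, then $\mathfrak T_{\rm buo}>T_{\rm buo}$; 2. if $P_0m_{\rm wc}=m_{\rm add}$, then $\mathfrak T_{\rm buo}=T_{\rm buo}$; 3. if $P_0m_{\rm wc}>m_{\rm add}$, then $\mathfrak T_{\rm buo}<T_{\rm buo}$.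 In particular, the effective buoyancy period is larger than the hydrostatic one for sufficiently large chamber heights $h_{\rm ch}$ and smaller for sufficiently small ones.
   Context: Positive constants: $\gamma$ (polytropic index), $P_{\rm atm}$, $\rho$, $g$, $h_{\rm ch}$ (chamber height), $h_0$ (still water depth), $L$ (wavelength), $m_{\rm wc}$, $\alpha=2r/h_{\rm w}$ with $r,h_{\rm w}>0$, $|\mathcal E_+|=\ell-r>0$. $h_{\rm wc}>0$ is the fluid height below the water column and $h(-r)>0$ is the fluid height at the left wall $x=-r$ of the structure (considered at a given time). In the dispersive case, $\widetilde\mu=\sqrt{\mu/3}$ with $\mu=h_0^2/L^2$. The coefficients are $$\mathcal T_{\rm buo}^2(h_{\rm wc})=T_{\rm buo}^2+\alpha|\mathcal E_+|+\frac{|\mathcal E_+|^2}{3h_{\rm wc}},\qquad\mathcal T^2_{\widetilde\mu,\rm buo}(h,h_{\rm wc})=\mathcal T_{\rm buo}^2(h_{\rm wc})+\frac{\widetilde\mu|\mathcal E_+|}{h(-r)}+\frac{\widetilde\mu^2}{h_{\rm wc}} .$$ $T_{\rm buo},\mathfrak T_{\rm buo}$ are the positive square roots. In the last sentence of the claim, all quantities other than $h_{\rm ch}$ (which enters only through $P_0$) are held fixed. *)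

theory Defs
  imports Complex_Main
begin

definition alpha :: "real \<Rightarrow> real \<Rightarrow> real" where
  "alpha r hw = 2 * r / hw"

text \<open>The length \<open>|E\<^sub>+|\<close> of the chamber, which extends from the right wall \<open>x = r\<close> of the
  structure to \<open>x = l\<close>.\<close>

definition Eplus_length :: "real \<Rightarrow> real \<Rightarrow> real" where
  "Eplus_length r l = l - r"

definition P0 :: "real \<Rightarrow> real \<Rightarrow> real \<Rightarrow> real \<Rightarrow> real \<Rightarrow> real" where
  "P0 \<gamma> Patm \<rho> g hch = \<gamma> * Patm / (\<rho> * g * hch)"

definition mu :: "real \<Rightarrow> real \<Rightarrow> real" where
  "mu h0 L = h0\<^sup>2 / L\<^sup>2"

text \<open>The parameter \<open>mt\<close> below stands for mu-tilde. It selects the model: \<open>mt = 0\<close> is the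
  hydrostatic (non-dispersive) case, and in the dispersive case \<open>mt = sqrt (mu h0 L / 3)\<close>.
  Only the dispersive coefficients involve the fluid height \<open>h\<close> (at a given time), through its
  value at the left wall \<open>x = -r\<close>.\<close>

definition T_buo :: "real \<Rightarrow> real \<Rightarrow> real \<Rightarrow> real" where
  "T_buo mwc h0 L = sqrt (mwc * h0\<^sup>2 / L\<^sup>2)"

definition calT_buo_sq ::
  "real \<Rightarrow> real \<Rightarrow> real \<Rightarrow> real \<Rightarrow> real \<Rightarrow> real \<Rightarrow> real \<Rightarrow> real" where
  "calT_buo_sq mwc h0 L r hw l hwc =
     (T_buo mwc h0 L)\<^sup>2 + alpha r hw * Eplus_length r l + (Eplus_length r l)\<^sup>2 / (3 * hwc)"

definition calT_mu_buo_sq ::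
  "real \<Rightarrow> real \<Rightarrow> real \<Rightarrow> real \<Rightarrow> real \<Rightarrow> real \<Rightarrow> real \<Rightarrow> (real \<Rightarrow> real) \<Rightarrow> real \<Rightarrow> real" where
  "calT_mu_buo_sq mwc h0 L r hw l mt h hwc =
     calT_buo_sq mwc h0 L r hw l hwc + mt * Eplus_length r l / h (- r) + mt\<^sup>2 / hwc"

definition m_add ::
  "real \<Rightarrow> real \<Rightarrow> real \<Rightarrow> real \<Rightarrow> real \<Rightarrow> real \<Rightarrow> (real \<Rightarrow> real) \<Rightarrow> real \<Rightarrow> real" where
  "m_add h0 L r hw l mt h hwc =
     (if mt = 0
      then L\<^sup>2 / h0\<^sup>2 * (alpha r hw * Eplus_length r l + (Eplus_length r l)\<^sup>2 / (3 * hwc))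
      else L\<^sup>2 / h0\<^sup>2 * (alpha r hw * Eplus_length r l + (Eplus_length r l)\<^sup>2 / (3 * hwc))
           + L * Eplus_length r l / (h0 * sqrt 3 * h (- r)) + 1 / (3 * hwc))"

text \<open>The effective analogue of \<open>T_buo\<close>; its first argument is the pressure coefficient \<open>P0\<close>.\<close>

definition eff_T_buo ::
  "real \<Rightarrow> real \<Rightarrow> real \<Rightarrow> real \<Rightarrow> real \<Rightarrow> real \<Rightarrow> real \<Rightarrow> real \<Rightarrow> (real \<Rightarrow> real) \<Rightarrow> real \<Rightarrow> real" where
  "eff_T_buo P mwc h0 L r hw l mt h hwc =
     sqrt ((if mt = 0 then calT_buo_sq mwc h0 L r hw l hwc
            else calT_mu_buo_sq mwc h0 L r hw l mt h hwc) / (1 + P))"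

definition hydrostatic_buoyancy_period :: "real \<Rightarrow> real \<Rightarrow> real \<Rightarrow> real" where
  "hydrostatic_buoyancy_period mwc h0 L = 2 * pi * T_buo mwc h0 L"

definition effective_buoyancy_period ::
  "real \<Rightarrow> real \<Rightarrow> real \<Rightarrow> real \<Rightarrow> real \<Rightarrow> real \<Rightarrow> real \<Rightarrow> real \<Rightarrow> (real \<Rightarrow> real) \<Rightarrow> real \<Rightarrow> real" where
  "effective_buoyancy_period P mwc h0 L r hw l mt h hwc =
     2 * pi * eff_T_buo P mwc h0 L r hw l mt h hwc"

end

theory Submission
  imports Defs
begin

text \<open>Rescaled by \<open>h0\<^sup>2 / L\<^sup>2\<close>, both models read \<open>T_buo\<^sup>2 = mwc\<close> and
  \<open>eff_T_buo\<^sup>2 = (mwc + m_add) / (1 + P0)\<close>, so comparing the two periods amounts to comparing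
  \<open>P0 * mwc\<close> with \<open>m_add\<close>. As \<open>P0\<close> is inversely proportional to the chamber height and
  \<open>m_add > 0\<close> does not depend on it, there is a single critical chamber height at which
  the order of the two periods is reversed.\<close>

lemma m_add_pos:
  assumes "h0 > 0" "L > 0" "r > 0" "hw > 0" "Eplus_length r l > 0" "hwc > 0" "h (- r) > 0"
  shows "m_add h0 L r hw l mt h hwc > 0"
proof -
  have "alpha r hw > 0"
    using assms by (simp add: alpha_def)
  then show ?thesis
    using assms by (simp add: m_add_def add_pos_pos)
qed

text \<open>\<open>m_add\<close> collects every term of the squared coefficient except
  \<open>T_buo\<close> squared, each divided by \<open>h0\<^sup>2 / L\<^sup>2\<close>; factoring
  this out leaves \<open>mwc + m_add\<close>.\<close>

lemma eff_T_buo_eq: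
  assumes "h0 > 0" "L > 0" "mwc > 0" "mt = 0 \<or> mt = sqrt (mu h0 L / 3)"
  shows "eff_T_buo P mwc h0 L r hw l mt h hwc =
    sqrt ((mwc + m_add h0 L r hw l mt h hwc) * (h0\<^sup>2 / L\<^sup>2) / (1 + P))"
proof -
  have T: "(T_buo mwc h0 L)\<^sup>2 = mwc * (h0\<^sup>2 / L\<^sup>2)"
    using assms by (simp add: T_buo_def)
  have hyd: "calT_buo_sq mwc h0 L r hw l hwc = (mwc + L\<^sup>2 / h0\<^sup>2 *
      (alpha r hw * Eplus_length r l + (Eplus_length r l)\<^sup>2 / (3 * hwc))) * (h0\<^sup>2 / L\<^sup>2)"
    using assms by (simp add: calT_buo_sq_def T distrib_right, simp add: add_divide_distrib)
  show ?thesis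
  proof (cases "mt = 0")
    case True
    then show ?thesis
      by (simp add: eff_T_buo_def m_add_def hyd)
  next
    case False
    \<comment> \<open>Hence \<open>L / (h0 * sqrt 3)\<close> times
      \<open>h0\<^sup>2 / L\<^sup>2\<close> is \<open>mt\<close>, and a third of
      \<open>h0\<^sup>2 / L\<^sup>2\<close> is \<open>mt\<^sup>2\<close>: the two dispersive terms
      match.\<close>
    with assms have "mt = h0 / (L * sqrt 3)"
      by (auto simp: mu_def real_sqrt_divide real_sqrt_mult)
    then have "mt * Eplus_length r l / h (- r) =
        L * Eplus_length r l / (h0 * sqrt 3 * h (- r)) * (h0\<^sup>2 / L\<^sup>2)"
      and "mt\<^sup>2 / hwc = 1 / (3 * hwc) * (h0\<^sup>2 / L\<^sup>2)"
      using assms(1-3) by (simp_all add: power2_eq_square mult_ac)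
    with False show ?thesis
      by (simp only: eff_T_buo_def calT_mu_buo_sq_def m_add_def hyd if_False distrib_right add.assoc)
  qed
qed

text \<open>Since \<open>1 + P > 0\<close>, comparing \<open>(mwc + m_add) / (1 + P)\<close> with
  \<open>mwc\<close> is comparing \<open>m_add\<close> with \<open>P * mwc\<close>. The real
  \<open>sqrt\<close> is strictly increasing on the whole line, so roots cancel without sign
  conditions.\<close>

lemma eff_T_buo_compare:
  assumes "h0 > 0" "L > 0" "mwc > 0" "mt = 0 \<or> mt = sqrt (mu h0 L / 3)" "P > 0"
  shows "T_buo mwc h0 L < eff_T_buo P mwc h0 L r hw l mt h hwc \<longleftrightarrow>
      P * mwc < m_add h0 L r hw l mt h hwc"
    and "eff_T_buo P mwc h0 L r hw l mt h hwc < T_buo mwc h0 L \<longleftrightarrow>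
      m_add h0 L r hw l mt h hwc < P * mwc"
proof -
  define m where "m = m_add h0 L r hw l mt h hwc"
  define c where "c = h0\<^sup>2 / L\<^sup>2"
  have c: "c > 0"
    using assms by (simp add: c_def)
  \<comment> \<open>The factor \<open>c\<close> is moved outermost so that it cancels against the
    one in \<open>T\<close>.\<close>
  have E: "eff_T_buo P mwc h0 L r hw l mt h hwc = sqrt (((mwc + m) / (1 + P)) * c)"
    using eff_T_buo_eq[OF assms(1-4)] by (simp add: m_def c_def)
  have T: "T_buo mwc h0 L = sqrt (mwc * c)"
    by (simp add: T_buo_def c_def)
  show "T_buo mwc h0 L < eff_T_buo P mwc h0 L r hw l mt h hwc \<longleftrightarrow>
      P * mwc < m_add h0 L r hw l mt h hwc"
    unfolding E T m_def[symmetric] real_sqrt_less_iff mult_less_cancel_right_pos[OF c]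
    using \<open>P > 0\<close> by (simp add: pos_less_divide_eq algebra_simps)
  show "eff_T_buo P mwc h0 L r hw l mt h hwc < T_buo mwc h0 L \<longleftrightarrow>
      m_add h0 L r hw l mt h hwc < P * mwc"
    unfolding E T m_def[symmetric] real_sqrt_less_iff mult_less_cancel_right_pos[OF c]
    using \<open>P > 0\<close> by (simp add: pos_divide_less_eq algebra_simps)
qed

theorem proposition5p6:
  fixes \<gamma> Patm \<rho> g hch h0 L mwc r hw l hwc mt :: real
    and h :: "real \<Rightarrow> real"
  assumes "\<gamma> > 0" and "Patm > 0" and "\<rho> > 0" and "g > 0" and "hch > 0"
    and "h0 > 0" and "L > 0" and "mwc > 0"
    and "r > 0" and "hw > 0" and "Eplus_length r l > 0"
    and "hwc > 0" and "h (- r) > 0"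
    and "mt = 0 \<or> mt = sqrt (mu h0 L / 3)"
  shows "(P0 \<gamma> Patm \<rho> g hch * mwc < m_add h0 L r hw l mt h hwc \<longrightarrow>
            eff_T_buo (P0 \<gamma> Patm \<rho> g hch) mwc h0 L r hw l mt h hwc > T_buo mwc h0 L)
       \<and> (P0 \<gamma> Patm \<rho> g hch * mwc = m_add h0 L r hw l mt h hwc \<longrightarrow>
            eff_T_buo (P0 \<gamma> Patm \<rho> g hch) mwc h0 L r hw l mt h hwc = T_buo mwc h0 L)
       \<and> (P0 \<gamma> Patm \<rho> g hch * mwc > m_add h0 L r hw l mt h hwc \<longrightarrow>
            eff_T_buo (P0 \<gamma> Patm \<rho> g hch) mwc h0 L r hw l mt h hwc < T_buo mwc h0 L)
       \<and> (\<exists>H>0. \<forall>hc>H.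
            effective_buoyancy_period (P0 \<gamma> Patm \<rho> g hc) mwc h0 L r hw l mt h hwc
              > hydrostatic_buoyancy_period mwc h0 L)
       \<and> (\<exists>H>0. \<forall>hc. 0 < hc \<and> hc < H \<longrightarrow>
            effective_buoyancy_period (P0 \<gamma> Patm \<rho> g hc) mwc h0 L r hw l mt h hwc
              < hydrostatic_buoyancy_period mwc h0 L)"
proof -
  define m where "m = m_add h0 L r hw l mt h hwc"
  \<comment> \<open>The critical height: the value of \<open>hc\<close> solving
    \<open>P0 \<gamma> Patm \<rho> g hc * mwc = m\<close>.\<close>
  define Hc where "Hc = \<gamma> * Patm / (\<rho> * g) * mwc / m"
  have m: "m > 0"
    unfolding m_def using assms by (intro m_add_pos)
  have Hc: "Hc > 0"
    using assms m by (simp add: Hc_def)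
  have P: "P0 \<gamma> Patm \<rho> g hc > 0" if "hc > 0" for hc
    using that assms by (simp add: P0_def)
  \<comment> \<open>At \<open>hc = 0\<close> both sides vanish because division by zero yields
    0.\<close>
  have critical: "P0 \<gamma> Patm \<rho> g hc * mwc = m * (Hc / hc)" for hc
    using m by (simp add: P0_def Hc_def)
  note compare = eff_T_buo_compare[where r = r and hw = hw and l = l and h = h and hwc = hwc,
      OF \<open>h0 > 0\<close> \<open>L > 0\<close> \<open>mwc > 0\<close> assms(14) P]
  \<comment> \<open>By \<open>critical\<close>, the order of the periods depends only on whether
    \<open>Hc / hc\<close> is below or above 1.\<close>
  have "effective_buoyancy_period (P0 \<gamma> Patm \<rho> g hc) mwc h0 L r hw l mt h hwc
      > hydrostatic_buoyancy_period mwc h0 L" if "hc > Hc" for hc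
  proof -
    have "hc > 0" "m * (Hc / hc) < m"
      using that Hc m by (simp_all add: pos_divide_less_eq)
    then show ?thesis
      by (simp add: effective_buoyancy_period_def hydrostatic_buoyancy_period_def
          compare(1) critical m_def[symmetric])
  qed
  moreover have "effective_buoyancy_period (P0 \<gamma> Patm \<rho> g hc) mwc h0 L r hw l mt h hwc
      < hydrostatic_buoyancy_period mwc h0 L" if "0 < hc" "hc < Hc" for hc
  proof -
    have "m < m * (Hc / hc)"
      using that m by (simp add: pos_less_divide_eq)
    then show ?thesis
      using that by (simp add: effective_buoyancy_period_def hydrostatic_buoyancy_period_def
          compare(2) critical m_def[symmetric])
  qed
  \<comment> \<open>\<open>Hc\<close> is the witness for both existential claims; in the case of
    equality neither strict order holds, so antisymmetry applies.\<close>
  ultimately show ?thesis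
    using Hc compare[OF \<open>hch > 0\<close>] by (auto intro: antisym simp: not_less[symmetric])
qed

end
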